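(* Let a triangle have side lengths $a,b,c$, circumradius $R$ and inradius $r$. If the triangle is Euclidean, then $$\frac{R}{r}\ \ge\ \frac{2\,s\left(\frac{a+b}{2}\right)s\left(\frac{a+c}{2}\right)s\left(\frac{b+c}{2}\right)}{s(a)s(b)s(c)}\ \ge\ 2,\qquad s(x)=\frac x2.$$ If the triangle is hyperbolic, then $$\frac{\tanh R}{\tanh r}\ \ge\ \frac{2\,s\left(\frac{a+b}{2}\right)s\left(\frac{a+c}{2}\right)s\left(\frac{b+c}{2}\right)}{s(a)s(b)s(c)}\ \ge\ 2,\qquad s(x)=\sinh\frac x2.$$ If the triangle is spherical, then $$\frac{\tan R}{\tan r}\ \ge\ \frac{2\,s\left(\frac{a+b}{2}\right)s\left(\frac{a+c}{2}\right)s\left(\frac{b+c}{2}\right)}{s(a)s(b)s(c)}\ \ge\ 2,\qquad s(x)=\sin\frac x2.$$ In each of the three geometries, equality holds in each of these inequalities if and only if $a=b=c$.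
   Context: Triangles are nondegenerate. Spherical triangles lie on the unit sphere $S^2$ (curvature $1$): the three vertices do not lie on a common great circle and the sides are the minor great-circle arcs joining them, so each side has length in $(0,\pi)$. Hyperbolic triangles lie in the hyperbolic plane of curvature $-1$; the hyperbolic triangle is assumed to have a circumscribed circle (through its three vertices), so that $R$ exists. $R$ and $r$ are the radii of the circumscribed and inscribed circles, measured in the metric of the respective geometry (in the spherical case, the spherical radii, in $(0,\pi/2)$). With $s(x)=\frac x2,\ \sin\frac x2,\ \sinh\frac x2$ in Euclidean, spherical and hyperbolic geometry respectively, the following formulas hold: $$\frac{2s(a)s(b)s(c)}{\sqrt{s(a+b-c)s(a+c-b)s(b+c-a)s(a+b+c)}}=R,\ \tan R,\ \tanh R,$$ $$\sqrt{\frac{s(a+b-c)s(a+c-b)s(b+c-a)}{s(a+b+c)}}=r,\ \tan r,\ \tanh r$$ in Euclidean, spherical and hyperbolic geometry respectively. *)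

theory Defs
  imports "HOL-Analysis.Analysis"
begin

text \<open>
  The sphere is the unit sphere of \<open>real^3\<close>, with the angular distance. The hyperbolic plane of
  curvature -1 is the hyperboloid model: the upper sheet of
  \<open>x\<^sub>1\<^sup>2 + x\<^sub>2\<^sup>2 - x\<^sub>3\<^sup>2 = -1\<close>, with \<open>cosh (hdist x y) = - lorentz x y\<close>.
\<close>

definition S2 :: "(real^3) set" where
  "S2 = sphere 0 1"

definition sdist :: "real^3 \<Rightarrow> real^3 \<Rightarrow> real" where
  "sdist x y = arccos (x \<bullet> y)"

definition lorentz :: "real^3 \<Rightarrow> real^3 \<Rightarrow> real" where
  "lorentz x y = x$1 * y$1 + x$2 * y$2 - x$3 * y$3"

definition H2 :: "(real^3) set" where
  "H2 = {x. lorentz x x = -1 \<and> x$3 > 0}"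

definition hdist :: "real^3 \<Rightarrow> real^3 \<Rightarrow> real" where
  "hdist x y = arcosh (- lorentz x y)"

definition great_circle :: "(real^3) set \<Rightarrow> bool" where
  "great_circle G \<longleftrightarrow> (\<exists>n. n \<noteq> 0 \<and> G = S2 \<inter> {x. n \<bullet> x = 0})"

text \<open>Hyperbolic lines are the nonempty sections of the hyperboloid by planes through the origin.\<close>

definition hyperbolic_line :: "(real^3) set \<Rightarrow> bool" where
  "hyperbolic_line L \<longleftrightarrow> (\<exists>n. n \<noteq> 0 \<and> L = H2 \<inter> {x. n \<bullet> x = 0}) \<and> L \<noteq> {}"

text \<open>
  Geodesic convex hulls of finite sets, by central projection from the origin. For two points
  (not antipodal, on the sphere) this is the geodesic segment between them, on the sphere the
  minor arc; for the vertices of a nondegenerate triangle it is the closed triangular region.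
\<close>

definition shull :: "(real^3) set \<Rightarrow> (real^3) set" where
  "shull V = S2 \<inter> convex_cone hull V"

definition hhull :: "(real^3) set \<Rightarrow> (real^3) set" where
  "hhull V = H2 \<inter> convex_cone hull V"

text \<open>
  The following two notions are for a plane with point set \<open>X\<close> and distance \<open>d\<close>. In the second one,
  \<open>hl\<close> is the geodesic convex hull operator, so that \<open>hl {A, B, C}\<close> is the triangle and
  \<open>hl {B, C}\<close> etc. are its sides; the inscribed circle is the one that bounds a disc lying in
  the triangle and that touches all three sides.
\<close>

definition circumradius ::
  "'a set \<Rightarrow> ('a \<Rightarrow> 'a \<Rightarrow> real) \<Rightarrow> 'a \<Rightarrow> 'a \<Rightarrow> 'a \<Rightarrow> real \<Rightarrow> bool" where
  "circumradius X d A B C R \<longleftrightarrow>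
     R > 0 \<and> (\<exists>P\<in>X. d P A = R \<and> d P B = R \<and> d P C = R)"

definition inradius ::
  "'a set \<Rightarrow> ('a \<Rightarrow> 'a \<Rightarrow> real) \<Rightarrow> ('a set \<Rightarrow> 'a set) \<Rightarrow> 'a \<Rightarrow> 'a \<Rightarrow> 'a \<Rightarrow> real \<Rightarrow> bool" where
  "inradius X d hl A B C r \<longleftrightarrow>
     r > 0 \<and> (\<exists>P\<in>X. {Q\<in>X. d P Q \<le> r} \<subseteq> hl {A, B, C} \<and>
       (\<exists>Q\<in>hl {B, C}. d P Q = r) \<and> (\<exists>Q\<in>hl {C, A}. d P Q = r) \<and> (\<exists>Q\<in>hl {A, B}. d P Q = r))"

definition mean_ratio :: "(real \<Rightarrow> real) \<Rightarrow> real \<Rightarrow> real \<Rightarrow> real \<Rightarrow> real" where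
  "mean_ratio s a b c =
     2 * s ((a + b) / 2) * s ((a + c) / 2) * s ((b + c) / 2) / (s a * s b * s c)"

end

theory Submission
  imports Defs
begin

text \<open>
  In all three geometries the radii satisfy \<open>T / t = 2 * s a * s b * s c / (x * y * z)\<close>, where
  \<open>x = s (b + c - a)\<close>, \<open>y = s (c + a - b)\<close>, \<open>z = s (a + b - c)\<close>, and \<open>T\<close>, \<open>t\<close> are the radii or their
  tangents or hyperbolic tangents. With \<open>m1, m2, m3\<close> the values of \<open>s\<close> at the means of two sides,
  the two claims are \<open>x y z m1 m2 m3 \<le> (s a s b s c)\<^sup>2\<close> and \<open>s a s b s c \<le> m1 m2 m3\<close>.

  Both come from the addition theorem \<open>s p * s q = s ((p + q) / 2)\<^sup>2 - s ((p - q) / 2)\<^sup>2\<close>. It gives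
  \<open>s b * s c \<le> m1\<^sup>2\<close> at once, and the product of three such inequalities is the second claim. For
  the first claim it gives \<open>y z m1\<^sup>2 \<le> (s a)\<^sup>2 * (s b * s c)\<close>, provided that \<open>s a < s b + s c\<close>
  (\<open>pair_of_sides_estimate\<close>); again three such inequalities are multiplied. Equality in any pair
  means that two sides agree. The lemma \<open>mean_ratio_bounds\<close> carries this out for an abstract \<open>s\<close>.

  The condition \<open>s a < s b + s c\<close> is the triangle inequality for the chords of the sides. On the
  sphere these are segments in space. In the hyperbolic plane the chords span a plane of the
  Lorentz space that is positive definite exactly when the vertices have a circumscribed circle.

  The formulas for the radii rest on vector algebra with a form of signature \<open>(1, 1, e)\<close>, with
  \<open>e = 1\<close> for the sphere and \<open>e = -1\<close> for the hyperboloid. The circumcentre has equal products with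
  the three vertices, the incentre has equal products with the three unit normals of the sides, and
  taking norms turns either fact into an equation between the radius and Gram determinants
  (\<open>circumcentre_relation\<close>, \<open>inscribed_circle_relation\<close>). That the incentre is at height \<open>r\<close> from
  each side has to be derived from the disc lying in the triangle and touching its sides
  (\<open>tangent_height\<close>). The Gram determinants are then expressed through \<open>s\<close> by trigonometric forms
  of Heron's formula. The Euclidean plane is treated in the same way, with signed areas in place of
  triple products.
\<close>

section \<open>The two inequalities for an abstract half-side function\<close>

text \<open>Heron's formula only gives the sign of a product of three factors. No two of
  them can both fail to be positive, since the corresponding differences of side lengths add up to
  twice a side; this settles the sign of each.\<close>

lemma three_positive_factors:
  fixes x y z :: real
  assumes "x * y * z > 0" "x > 0 \<or> y > 0" "y > 0 \<or> z > 0" "x > 0 \<or> z > 0"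
  shows "x > 0" "y > 0" "z > 0"
  using assms by (smt (verit, best) mult_nonneg_nonpos mult_nonpos_nonneg mult_pos_pos)+

text \<open>The estimate behind the first inequality. For the sides \<open>a, b, c\<close> it is read with
  \<open>p = s a\<close>, \<open>q = s b\<close>, \<open>r = s c\<close>, \<open>m = s ((b + c) / 2)\<close>, \<open>d = s ((b - c) / 2)\<close>,
  \<open>y = s (c + a - b)\<close>, \<open>z = s (a + b - c)\<close>, where \<open>k\<close> is the companion (cosine) of \<open>d\<close>. Both sides
  are polynomials in \<open>p, m, d, k\<close>, and their difference factors as
  \<open>d\<^sup>2 * ((q + r)\<^sup>2 - p\<^sup>2)\<close>: the only inequality about the triangle that is involved is
  \<open>s a < s b + s c\<close>.\<close>

lemma pair_of_sides_estimate:
  fixes p q r m d k y z :: real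
  assumes pos: "q > 0" "r > 0" "p > 0" and tri: "p < q + r"
    and qr: "q * r = m\<^sup>2 - d\<^sup>2" and yz: "y * z = p\<^sup>2 - (2 * d * k)\<^sup>2" and add: "q + r = 2 * m * k"
  shows "y * z * m\<^sup>2 \<le> p\<^sup>2 * (q * r)" "y * z * m\<^sup>2 = p\<^sup>2 * (q * r) \<longleftrightarrow> d = 0"
proof -
  have "p\<^sup>2 * (q * r) - y * z * m\<^sup>2 = d\<^sup>2 * ((q + r)\<^sup>2 - p\<^sup>2)"
    unfolding qr yz add by algebra
  moreover have "(q + r)\<^sup>2 - p\<^sup>2 > 0"
    using tri pos by (simp add: power_strict_mono)
  ultimately show "y * z * m\<^sup>2 \<le> p\<^sup>2 * (q * r)" "y * z * m\<^sup>2 = p\<^sup>2 * (q * r) \<longleftrightarrow> d = 0"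
    by (smt (verit, best) mult_eq_0_iff zero_le_mult_iff zero_le_power2 power_eq_0_iff pos2)+
qed

lemma product_of_three_mono:
  fixes u1 u2 u3 v1 v2 v3 :: real
  assumes pos: "0 < u1" "0 < u2" "0 < u3" and le: "u1 \<le> v1" "u2 \<le> v2" "u3 \<le> v3"
  shows "u1 * u2 * u3 \<le> v1 * v2 * v3"
    and "u1 * u2 * u3 = v1 * v2 * v3 \<longleftrightarrow> u1 = v1 \<and> u2 = v2 \<and> u3 = v3"
proof -
  have v: "0 < v1" "0 < v2" using pos le by linarith+
  have chain: "u1 * u2 * u3 \<le> v1 * u2 * u3" "v1 * u2 * u3 \<le> v1 * v2 * u3" "v1 * v2 * u3 \<le> v1 * v2 * v3"
    using pos le v by simp_all
  then show "u1 * u2 * u3 \<le> v1 * v2 * v3" by linarith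
  show "u1 * u2 * u3 = v1 * v2 * v3 \<longleftrightarrow> u1 = v1 \<and> u2 = v2 \<and> u3 = v3"
  proof
    assume "u1 * u2 * u3 = v1 * v2 * v3"
    with chain have "u1 * u2 * u3 = v1 * u2 * u3" "v1 * u2 * u3 = v1 * v2 * u3" "v1 * v2 * u3 = v1 * v2 * v3"
      by linarith+
    then show "u1 = v1 \<and> u2 = v2 \<and> u3 = v3" using pos v by simp
  qed simp
qed

text \<open>The whole theorem once the geometry has been reduced to four facts: Heron's formula for a
  quantity \<open>D\<close>, the expressions of \<open>D\<close> through the two radii, and the triangle inequalities for
  \<open>s a, s b, s c\<close>, given as positivity of the Heron product. The functions \<open>x / 2\<close>, \<open>sin (x / 2)\<close> and
  \<open>sinh (x / 2)\<close>, with companions \<open>1\<close>, \<open>cos (x / 2)\<close> and \<open>cosh (x / 2)\<close>, satisfy the same three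
  functional equations, so that one argument serves the three geometries.\<close>

lemma mean_ratio_bounds:
  fixes s k :: "real \<Rightarrow> real" and a b c T t D :: real
  assumes prod: "\<And>x y. s x * s y = (s ((x + y) / 2))\<^sup>2 - (s ((x - y) / 2))\<^sup>2"
    and dbl: "\<And>x. s (2 * x) = 2 * s x * k x"
    and add: "\<And>x y. s x + s y = 2 * s ((x + y) / 2) * k ((x - y) / 2)"
    and zero: "s ((a - b) / 2) = 0 \<longleftrightarrow> a = b" "s ((b - c) / 2) = 0 \<longleftrightarrow> b = c" "s ((c - a) / 2) = 0 \<longleftrightarrow> c = a"
    and pos: "s a > 0" "s b > 0" "s c > 0"
    and means: "s ((a + b) / 2) > 0" "s ((b + c) / 2) > 0" "s ((a + c) / 2) > 0"
    and chord: "(s a + s b + s c) * ((s b + s c - s a) * (s c + s a - s b) * (s a + s b - s c)) > 0"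
    and excess: "s (a + b + c) > 0" "s (b + c - a) > 0" "s (c + a - b) > 0" "s (a + b - c) > 0"
    and heron: "D = 4 * s (a + b + c) * (s (b + c - a) * s (c + a - b) * s (a + b - c))"
    and circ: "T > 0" "T\<^sup>2 * D = 16 * (s a * s b * s c)\<^sup>2"
    and inc: "t > 0" "4 * t\<^sup>2 * (s (a + b + c))\<^sup>2 = D"
  shows "T / t \<ge> mean_ratio s a b c \<and> mean_ratio s a b c \<ge> 2 \<and>
    (T / t = mean_ratio s a b c \<longleftrightarrow> a = b \<and> b = c) \<and> (mean_ratio s a b c = 2 \<longleftrightarrow> a = b \<and> b = c)"
proof -
  define x y z where "x = s (b + c - a)" and "y = s (c + a - b)" and "z = s (a + b - c)"
  define m1 m2 m3 where "m1 = s ((b + c) / 2)" and "m2 = s ((c + a) / 2)" and "m3 = s ((a + b) / 2)"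
  define P where "P = s a * s b * s c"
  define M where "M = m1 * m2 * m3"
  have xyz: "x > 0" "y > 0" "z > 0" using excess by (auto simp: x_def y_def z_def)
  have m: "m1 > 0" "m2 > 0" "m3 > 0" using means by (auto simp: m1_def m2_def m3_def add.commute)
  have P: "P > 0" and M: "M > 0" using pos m by (auto simp: P_def M_def)
  have tri: "s a < s b + s c" "s b < s c + s a" "s c < s a + s b"
  proof -
    have "(s b + s c - s a) * (s c + s a - s b) * (s a + s b - s c) > 0"
      using chord pos by (simp add: zero_less_mult_iff)
    from three_positive_factors[OF this] pos
    show "s a < s b + s c" "s b < s c + s a" "s c < s a + s b" by linarith+
  qed
  have ratio: "T / t = 2 * P / (x * y * z)"
  proof -
    have D_eq: "D = 4 * s (a+b+c) * (x * y * z)" using heron by (simp add: x_def y_def z_def)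
    with inc(2) have "(t\<^sup>2 * s (a+b+c)) * s (a+b+c) = (x * y * z) * s (a+b+c)"
      by algebra
    then have 2: "t\<^sup>2 * s (a+b+c) = x * y * z" using excess(1) by (metis less_irrefl mult_right_cancel)
    have "T\<^sup>2 * (4 * s (a+b+c) * (x * y * z)) = 16 * P\<^sup>2"
      using circ(2) D_eq by (simp add: P_def)
    then have "T\<^sup>2 * (4 * (t\<^sup>2 * s (a+b+c)) * (x * y * z)) = t\<^sup>2 * (16 * P\<^sup>2)"
      by algebra
    then have "(T * (x * y * z))\<^sup>2 = (2 * t * P)\<^sup>2"
      unfolding 2 by algebra
    then have "T * (x * y * z) = 2 * t * P"
      using circ inc P xyz by (simp add: power2_eq_iff_nonneg)
    then show ?thesis using inc(1) xyz by (simp add: field_simps)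
  qed
  have mean: "mean_ratio s a b c = 2 * M / P"
    by (simp add: mean_ratio_def M_def P_def m1_def m2_def m3_def ac_simps)
  have d: "2 * s ((p - q) / 2) * k ((p - q) / 2) = s (p - q)" for p q
    using dbl[of "(p - q) / 2"] by (metis divide_numeral_1 mult_numeral_1 nonzero_mult_div_cancel_left times_divide_eq_right zero_neq_numeral)
  have prd: "s (u + v - w) * s (w + u - v) = (s u)\<^sup>2 - (s (v - w))\<^sup>2" for u v w
    using prod[of "u + v - w" "w + u - v"] by (simp add: algebra_simps diff_divide_distrib add_divide_distrib)
  \<comment> \<open>Each excess \<open>x, y, z\<close> occurs in two of the three pair estimates, so their product is the
    square of the inequality \<open>x * y * z * M \<le> P\<^sup>2\<close> that compares the two ratios.\<close>
  have e1: "z * y * m1\<^sup>2 \<le> (s a)\<^sup>2 * (s b * s c)" "z * y * m1\<^sup>2 = (s a)\<^sup>2 * (s b * s c) \<longleftrightarrow> b = c"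
    using pair_of_sides_estimate[OF pos(2,3,1) tri(1) prod _ add, of z y] prd[of a b c] zero
    by (simp_all add: d m1_def y_def z_def)
  have e2: "x * z * m2\<^sup>2 \<le> (s b)\<^sup>2 * (s c * s a)" "x * z * m2\<^sup>2 = (s b)\<^sup>2 * (s c * s a) \<longleftrightarrow> c = a"
    using pair_of_sides_estimate[OF pos(3,1,2) tri(2) prod _ add, of x z] prd[of b c a] zero
    by (simp_all add: d m2_def x_def z_def)
  have e3: "y * x * m3\<^sup>2 \<le> (s c)\<^sup>2 * (s a * s b)" "y * x * m3\<^sup>2 = (s c)\<^sup>2 * (s a * s b) \<longleftrightarrow> a = b"
    using pair_of_sides_estimate[OF pos(1,2,3) tri(3) prod _ add, of y x] prd[of c a b] zero
    by (simp_all add: d m3_def y_def x_def)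
  have sq: "(z * y * m1\<^sup>2) * (x * z * m2\<^sup>2) * (y * x * m3\<^sup>2) = (x * y * z * M)\<^sup>2"
    "((s a)\<^sup>2 * (s b * s c)) * ((s b)\<^sup>2 * (s c * s a)) * ((s c)\<^sup>2 * (s a * s b)) = (P\<^sup>2)\<^sup>2"
    unfolding M_def P_def by algebra+
  have "(x * y * z * M)\<^sup>2 \<le> (P\<^sup>2)\<^sup>2" "(x * y * z * M)\<^sup>2 = (P\<^sup>2)\<^sup>2 \<longleftrightarrow> b = c \<and> c = a \<and> a = b"
    using product_of_three_mono[OF _ _ _ e1(1) e2(1) e3(1)] xyz m e1(2) e2(2) e3(2) unfolding sq by simp_all
  then have up: "x * y * z * M \<le> P\<^sup>2" "x * y * z * M = P\<^sup>2 \<longleftrightarrow> a = b \<and> b = c"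
    using xyz M power2_le_imp_le[of "x * y * z * M" "P\<^sup>2"] power2_eq_iff_nonneg[of "x * y * z * M" "P\<^sup>2"]
    by auto
  \<comment> \<open>For the second inequality each factor is compared alone: \<open>s b * s c \<le> m1\<^sup>2\<close>.\<close>
  have f: "s p * s q \<le> (s ((p + q) / 2))\<^sup>2"
    "s p * s q = (s ((p + q) / 2))\<^sup>2 \<longleftrightarrow> s ((p - q) / 2) = 0" for p q
    using prod[of p q] by simp_all
  have "(s b * s c) * (s c * s a) * (s a * s b) \<le> m1\<^sup>2 * m2\<^sup>2 * m3\<^sup>2"
     "(s b * s c) * (s c * s a) * (s a * s b) = m1\<^sup>2 * m2\<^sup>2 * m3\<^sup>2 \<longleftrightarrow> b = c \<and> c = a \<and> a = b"
    using product_of_three_mono[OF _ _ _ f(1)[of b c] f(1)[of c a] f(1)[of a b]] pos zero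
    unfolding f(2) by (simp_all add: m1_def m2_def m3_def)
  moreover have "(s b * s c) * (s c * s a) * (s a * s b) = P\<^sup>2" "m1\<^sup>2 * m2\<^sup>2 * m3\<^sup>2 = M\<^sup>2"
    unfolding M_def P_def by algebra+
  ultimately have low: "P \<le> M" "P = M \<longleftrightarrow> a = b \<and> b = c"
    using P M power2_le_imp_le[of P M] power2_eq_iff_nonneg[of P M] by auto
  have "2 * M / P \<le> 2 * P / (x * y * z)" "2 * P / (x * y * z) = 2 * M / P \<longleftrightarrow> x * y * z * M = P\<^sup>2"
    using up(1) P xyz by (auto simp: field_simps power2_eq_square)
  moreover have "2 * M / P \<ge> 2" "2 * M / P = 2 \<longleftrightarrow> P = M"
    using low(1) P by (auto simp: field_simps)
  ultimately show ?thesis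
    unfolding ratio mean using up(2) low(2) by simp
qed

section \<open>Vector algebra with a form of signature \<open>(1, 1, e)\<close>\<close>

text \<open>
  The inner product for \<open>e = 1\<close> and the Lorentz form for \<open>e = -1\<close>. Both model surfaces satisfy
  \<open>form e x x = e\<close>, and distances are read off from \<open>form e x y = e * cos d\<close> and
  \<open>form e x y = e * cosh d\<close>, so that vector algebra with \<open>e\<close> as a parameter covers both.
\<close>

definition form :: "real \<Rightarrow> real^3 \<Rightarrow> real^3 \<Rightarrow> real" where
  "form e x y = x$1 * y$1 + x$2 * y$2 + e * (x$3 * y$3)"

definition triple :: "real^3 \<Rightarrow> real^3 \<Rightarrow> real^3 \<Rightarrow> real" where
  "triple x y z = x \<bullet> cross3 y z"

lemma triple_coords:
  "triple x y z = x$1 * (y$2 * z$3 - y$3 * z$2) + x$2 * (y$3 * z$1 - y$1 * z$3) + x$3 * (y$1 * z$2 - y$2 * z$1)"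
  by (simp add: triple_def cross3_simps)

lemma form_commute: "form e x y = form e y x"
  by (simp add: form_def mult.commute)

lemma form_one: "form 1 x y = x \<bullet> y"
  by (simp add: form_def inner_vec_def sum_3)

lemma form_minus_one: "form (-1) x y = lorentz x y"
  by (simp add: form_def lorentz_def)

lemma triple_rotate: "triple x y z = triple y z x"
  by (simp add: triple_coords algebra_simps)

text \<open>The Gram matrix of the rows of \<open>M\<close> is \<open>M J M\<^sup>T\<close> with \<open>J = diag (1, 1, e)\<close>, hence the factor \<open>e\<close>.\<close>

lemma gram_determinant:
  "e * (triple x y z)\<^sup>2 = form e x x * form e y y * form e z z + 2 * form e x y * form e y z * form e z x
     - form e x x * (form e y z)\<^sup>2 - form e y y * (form e z x)\<^sup>2 - form e z z * (form e x y)\<^sup>2"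
  unfolding triple_coords form_def by algebra

lemma coplanar_if_triple_zero:
  assumes "triple x y z = 0"
  obtains n where "n \<noteq> 0" "n \<bullet> x = 0" "n \<bullet> y = 0" "n \<bullet> z = 0"
proof -
  have "det (vector [x, y, z] :: real^3^3) = 0"
    using assms by (simp add: triple_def dot_cross_det)
  then obtain n where "n \<noteq> 0" and n: "(vector [x, y, z] :: real^3^3) *v n = 0"
    by (metis invertible_det_nz matrix_left_invertible_ker invertible_left_inverse)
  have "x \<bullet> n = 0 \<and> y \<bullet> n = 0 \<and> z \<bullet> n = 0"
    using n by (simp add: vec_eq_iff forall_3 matrix_vector_mult_def inner_vec_def vector_def)
  then show thesis using that[OF \<open>n \<noteq> 0\<close>] by (simp add: inner_commute)
qed

section \<open>Circumscribed and inscribed circles on the sphere and the hyperboloid\<close>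

text \<open>The circumcentre is determined by its equal products with the vertices:
  \<open>triple A B C *\<^sub>R P\<close> is, up to \<open>J = diag (1, 1, e)\<close>, the combination of
  \<open>B \<times> C\<close>, \<open>C \<times> A\<close>, \<open>A \<times> B\<close> with the coefficients \<open>form e P A\<close>, \<open>form e P B\<close>, \<open>form e P C\<close>. Its norm gives
  the first equation, whose second factor is the Gram determinant of the chords \<open>B - A\<close> and
  \<open>C - A\<close>.\<close>

lemma circumcentre_relation:
  assumes e: "e = 1 \<or> e = -1"
    and P: "form e P P = e" "form e P A = e * t" "form e P B = e * t" "form e P C = e * t"
    and ABC: "form e A A = e" "form e B B = e" "form e C C = e"
      "form e B C = e * x" "form e C A = e * y" "form e A B = e * z"
  shows "(triple A B C)\<^sup>2 = t\<^sup>2 * (4 * (1 - y) * (1 - z) - (1 + x - y - z)\<^sup>2)"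
    "(triple A B C)\<^sup>2 = 1 + 2 * x * y * z - x\<^sup>2 - y\<^sup>2 - z\<^sup>2"
proof -
  have ee: "e * e = 1" using e by auto
  show gram: "(triple A B C)\<^sup>2 = 1 + 2 * x * y * z - x\<^sup>2 - y\<^sup>2 - z\<^sup>2"
    using gram_determinant[of e A B C] ee unfolding ABC by algebra
  define M where "M = form e P A *\<^sub>R cross3 B C + form e P B *\<^sub>R cross3 C A + form e P C *\<^sub>R cross3 A B"
  have M: "triple A B C * P$1 = M$1" "triple A B C * P$2 = M$2" "e * (triple A B C * P$3) = M$3"
    unfolding M_def triple_coords form_def by (simp_all add: cross3_def) algebra+
  \<comment> \<open>\<open>N\<close> is \<open>e\<close> times the form that \<open>form e\<close> induces on normal vectors; the Lagrange identity for it
    is \<open>N_cross\<close>.\<close>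
  define N where "N v w = e * (v$1 * w$1 + v$2 * w$2) + v$3 * w$3" for v w :: "real^3"
  have N_cross: "N (cross3 u v) (cross3 w z) = form e u w * form e v z - form e u z * form e v w" for u v w z
    unfolding N_def form_def by (simp add: cross3_def) algebra
  have "e * (triple A B C)\<^sup>2 * form e P P = N M M"
    unfolding N_def M[symmetric] form_def by algebra
  also have "\<dots> = (form e P A)\<^sup>2 * N (cross3 B C) (cross3 B C) + (form e P B)\<^sup>2 * N (cross3 C A) (cross3 C A)
    + (form e P C)\<^sup>2 * N (cross3 A B) (cross3 A B)
    + 2 * form e P A * form e P B * N (cross3 B C) (cross3 C A)
    + 2 * form e P B * form e P C * N (cross3 C A) (cross3 A B)
    + 2 * form e P C * form e P A * N (cross3 A B) (cross3 B C)"
    unfolding N_def M_def by (simp add: algebra_simps power2_eq_square)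
  finally have four: "e * (triple A B C)\<^sup>2 * e =
      e\<^sup>2 * t\<^sup>2 * e\<^sup>2 * ((1 - x\<^sup>2) + (1 - y\<^sup>2) + (1 - z\<^sup>2)
      + 2 * (x * y - z) + 2 * (y * z - x) + 2 * (z * x - y))"
    unfolding N_cross P ABC form_commute[of e C B] form_commute[of e A C] form_commute[of e B A]
    by (simp add: algebra_simps power2_eq_square)
  show "(triple A B C)\<^sup>2 = t\<^sup>2 * (4 * (1 - y) * (1 - z) - (1 + x - y - z)\<^sup>2)"
    using four ee by algebra
qed

text \<open>Dually, the incentre is determined by its equal distances to the sides, that is by its
  coordinates in the basis \<open>A, B, C\<close>, which are \<open>triple I B C / triple A B C\<close> etc. by Cramer's rule.\<close>

lemma incentre_relation:
  assumes e: "e = 1 \<or> e = -1"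
    and I: "form e I I = e"
    and heights: "triple I B C = \<alpha> * S" "triple I C A = \<beta> * S" "triple I A B = \<gamma> * S"
    and ABC: "form e A A = e" "form e B B = e" "form e C C = e"
      "form e B C = e * x" "form e C A = e * y" "form e A B = e * z"
  shows "(triple A B C)\<^sup>2 = S\<^sup>2 * (\<alpha>\<^sup>2 + \<beta>\<^sup>2 + \<gamma>\<^sup>2 + 2 * \<alpha> * \<beta> * z + 2 * \<beta> * \<gamma> * x + 2 * \<gamma> * \<alpha> * y)"
proof -
  have ee: "e * e = 1" using e by auto
  have "triple A B C * I$1 = triple I B C * A$1 + triple I C A * B$1 + triple I A B * C$1"
    "triple A B C * I$2 = triple I B C * A$2 + triple I C A * B$2 + triple I A B * C$2"
    "triple A B C * I$3 = triple I B C * A$3 + triple I C A * B$3 + triple I A B * C$3"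
    unfolding triple_coords by algebra+
  then have "(triple A B C)\<^sup>2 * form e I I =
      (triple I B C)\<^sup>2 * form e A A + (triple I C A)\<^sup>2 * form e B B + (triple I A B)\<^sup>2 * form e C C
    + 2 * triple I B C * triple I C A * form e A B + 2 * triple I C A * triple I A B * form e B C
    + 2 * triple I A B * triple I B C * form e C A"
    unfolding form_def by algebra
  then show ?thesis unfolding I heights ABC using ee by algebra
qed

text \<open>A disc that lies on one side of the line \<open>BC\<close> and touches it has its centre at height exactly
  the radius. Here \<open>K\<close> and \<open>S\<close> are the cosine and sine (or \<open>cosh\<close> and \<open>sinh\<close>) of the radius, and
  \<open>h\<close> is the same sine for the distance from \<open>I\<close> to the line. The point \<open>Q\<close> of the line forces
  \<open>h\<^sup>2 \<le> S\<^sup>2\<close>, because the Gram determinant of \<open>I\<close>, the unit normal \<open>n\<close> and \<open>Q\<close> is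
  \<open>e\<close> times a square. Conversely the boundary point \<open>X\<close> of the disc that is reached from \<open>I\<close> by moving along
  \<open>- n\<close> must not have crossed the line, which is \<open>S\<^sup>2 \<le> h\<^sup>2\<close>. The sign \<open>\<sigma>\<close> selects the
  side of the line.\<close>

lemma tangent_height:
  assumes e: "e = 1 \<or> e = -1"
    and I: "form e I I = e" and B: "form e B B = e" and C: "form e C C = e" and BC: "form e B C = e * x"
    and \<alpha>: "\<alpha> > 0" "\<alpha>\<^sup>2 = e * (1 - x\<^sup>2)"
    and CS: "K > 0" "S > 0" "K\<^sup>2 + e * S\<^sup>2 = 1"
    and \<sigma>: "\<sigma>\<^sup>2 = 1"
    and inside: "0 \<le> \<sigma> * triple I B C"
    and disc: "\<And>Q. form e Q Q = e \<Longrightarrow> form e I Q = e * K \<Longrightarrow> 0 \<le> \<sigma> * triple Q B C"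
    and Q: "form e Q Q = e" "form e I Q = e * K" "triple Q B C = 0"
  shows "\<sigma> * triple I B C = \<alpha> * S"
proof -
  have ee: "e * e = 1" using e by auto
  define n :: "real^3" where "n = (\<sigma> / \<alpha>) *\<^sub>R vector [cross3 B C $ 1, cross3 B C $ 2, e * cross3 B C $ 3]"
  have n: "form e X n = \<sigma> * triple X B C / \<alpha>" for X
    using e by (elim disjE) (simp_all add: form_def n_def triple_def inner_vec_def sum_3 distrib_left add_divide_distrib ac_simps)
  have nn: "form e n n = 1"
  proof -
    have "\<alpha>\<^sup>2 * form e n n = \<sigma>\<^sup>2 * ((cross3 B C $ 1)\<^sup>2 + (cross3 B C $ 2)\<^sup>2 + e * (e * cross3 B C $ 3)\<^sup>2)"
      using \<alpha>(1) by (simp add: form_def n_def field_simps power2_eq_square)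
    also have "\<dots> = e * (form e B B * form e C C - (form e B C)\<^sup>2)"
    proof -
      have "form e B B * form e C C - (form e B C)\<^sup>2
          = e * ((cross3 B C $ 1)\<^sup>2 + (cross3 B C $ 2)\<^sup>2) + (cross3 B C $ 3)\<^sup>2"
        unfolding form_def by (simp add: cross3_def) algebra
      then show ?thesis using ee \<sigma> by algebra
    qed
    also have "\<dots> = \<alpha>\<^sup>2" unfolding B C BC \<alpha>(2) using ee by algebra
    finally show ?thesis using \<alpha>(1) by simp
  qed
  define h where "h = form e I n"
  have h0: "h \<ge> 0" using inside \<alpha>(1) by (simp add: h_def n)
  have Qn: "form e Q n = 0" using Q(3) by (simp add: n)
  have "e * (triple I n Q)\<^sup>2 = e * e - (e * K)\<^sup>2 - e * h\<^sup>2"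
    using gram_determinant[of e I n Q]
    unfolding I nn Q(1) h_def[symmetric] form_commute[of e n Q] Qn form_commute[of e Q I] Q(2)
    by simp
  then have g: "S\<^sup>2 - h\<^sup>2 = (triple I n Q)\<^sup>2"
    using ee CS(3) by algebra
  then have hS: "h\<^sup>2 \<le> S\<^sup>2" by (metis diff_ge_0_iff_ge zero_le_power2)
  \<comment> \<open>\<open>w\<close> is the length of the component of \<open>n\<close> orthogonal to \<open>I\<close>.\<close>
  define w2 where "w2 = 1 - e * h\<^sup>2"
  have w2: "w2 > 0"
    using e
  proof
    assume "e = 1"
    then have "K\<^sup>2 = 1 - S\<^sup>2" using CS(3) by simp
    moreover have "K\<^sup>2 > 0" using CS(1) by simp
    ultimately show ?thesis using hS \<open>e = 1\<close> by (simp add: w2_def)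
  qed (simp add: w2_def add_pos_nonneg)
  define w where "w = sqrt w2"
  have w: "w > 0" "w\<^sup>2 = w2" using w2 by (auto simp: w_def)
  define X where "X = K *\<^sub>R I - (S / w) *\<^sub>R (n - (e * h) *\<^sub>R I)"
  have lin: "form e u X = K * form e u I - (S / w) * (form e u n - e * h * form e u I)" for u
    by (simp add: form_def X_def algebra_simps)
  have IX: "form e I X = e * K"
    using ee by (simp add: lin I h_def[symmetric])
  have w2S: "S * (w * w) + S * (e * (h * h)) = S"
    using w(2) unfolding w2_def by algebra
  have nX: "form e n X = K * h - S * w"
    unfolding lin nn form_commute[of e n I] h_def[symmetric]
    using w(1) w2S by (simp add: field_simps)
  have "form e X X = K * (e * K) - (S / w) * ((K * h - S * w) - e * h * (e * K))"
    using lin[of X] unfolding form_commute[of e X I] form_commute[of e X n] IX nX .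
  also have "\<dots> = e * K\<^sup>2 + S\<^sup>2"
  proof -
    have "e * h * (e * K) = h * K" using ee by algebra
    have "(S / w) * ((K * h - S * w) - e * h * (e * K)) = - (S / w * w) * S"
      unfolding \<open>e * h * (e * K) = h * K\<close> by (simp add: algebra_simps)
    then show ?thesis using w(1) by (simp add: power2_eq_square)
  qed
  also have "\<dots> = e" using ee CS(3) by algebra
  finally have "0 \<le> \<sigma> * triple X B C" by (rule disc[OF _ IX])
  then have "0 \<le> form e n X" using \<alpha>(1) unfolding form_commute[of e n X] n by simp
  then have "S * w \<le> K * h" by (simp add: nX)
  then have "(S * w)\<^sup>2 \<le> (K * h)\<^sup>2" using CS w by (intro power_mono) auto
  moreover have "K\<^sup>2 = 1 - e * S\<^sup>2" using CS(3) by simp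
  ultimately have "S\<^sup>2 * (1 - e * h\<^sup>2) \<le> (1 - e * S\<^sup>2) * h\<^sup>2"
    using w(2) by (simp only: w2_def power_mult_distrib)
  then have "S\<^sup>2 \<le> h\<^sup>2" by (simp add: algebra_simps)
  with hS have "h\<^sup>2 = S\<^sup>2" by (rule antisym)
  then have "h = S" by (rule power2_eq_imp_eq) (use h0 CS(2) in simp_all)
  then have "\<sigma> * triple I B C / \<alpha> = S" unfolding h_def n .
  then show ?thesis using \<alpha>(1) by (simp add: divide_eq_eq mult.commute)
qed

lemma cone_hull_side:
  assumes "Q \<in> convex_cone hull {A, B, C}"
  shows "0 \<le> sgn (triple A B C) * triple Q B C"
proof -
  have "convex_cone hull {A, B, C} \<subseteq> {X. 0 \<le> (sgn (triple A B C) *\<^sub>R cross3 B C) \<bullet> X}"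
  proof (rule hull_minimal)
    have "cross3 B C \<bullet> A = triple A B C" "cross3 B C \<bullet> B = 0" "cross3 B C \<bullet> C = 0"
      by (simp_all add: triple_def inner_commute dot_cross_self)
    then show "{A, B, C} \<subseteq> {X. 0 \<le> (sgn (triple A B C) *\<^sub>R cross3 B C) \<bullet> X}"
      by (simp add: sgn_if)
  qed (rule convex_cone_halfspace_ge)
  with assms show ?thesis by (auto simp: triple_def inner_commute)
qed

lemma cone_hull_edge:
  assumes "Q \<in> convex_cone hull {B, C}"
  shows "triple Q B C = 0"
proof -
  have "convex_cone hull {B, C} \<subseteq> {X. triple X B C = 0}"
    by (rule hull_minimal) (auto simp: convex_cone_iff triple_def inner_simps dot_cross_self)
  with assms show ?thesis by auto
qed

text \<open>With the tangency conditions at the three sides, each side contributes the height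
  \<open>\<alpha> * S\<close>, where \<open>\<alpha>\<close> is the length of \<open>B \<times> C\<close>, that is \<open>sin a\<close> or \<open>sinh a\<close>.\<close>

lemma inscribed_circle_relation:
  assumes e: "e = 1 \<or> e = -1"
    and ABC: "form e A A = e" "form e B B = e" "form e C C = e"
      "form e B C = e * x" "form e C A = e * y" "form e A B = e * z"
    and V: "triple A B C \<noteq> 0"
    and sides: "\<alpha> > 0" "\<alpha>\<^sup>2 = e * (1 - x\<^sup>2)" "\<beta> > 0" "\<beta>\<^sup>2 = e * (1 - y\<^sup>2)" "\<gamma> > 0" "\<gamma>\<^sup>2 = e * (1 - z\<^sup>2)"
    and KS: "K > 0" "S > 0" "K\<^sup>2 + e * S\<^sup>2 = 1"
    and I: "form e I I = e" "I \<in> convex_cone hull {A, B, C}"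
    and disc: "\<And>Q. form e Q Q = e \<Longrightarrow> form e I Q = e * K \<Longrightarrow> Q \<in> convex_cone hull {A, B, C}"
    and touch: "form e Qa Qa = e" "form e I Qa = e * K" "Qa \<in> convex_cone hull {B, C}"
      "form e Qb Qb = e" "form e I Qb = e * K" "Qb \<in> convex_cone hull {C, A}"
      "form e Qc Qc = e" "form e I Qc = e * K" "Qc \<in> convex_cone hull {A, B}"
  shows "(triple A B C)\<^sup>2 = S\<^sup>2 * (\<alpha>\<^sup>2 + \<beta>\<^sup>2 + \<gamma>\<^sup>2 + 2 * \<alpha> * \<beta> * z + 2 * \<beta> * \<gamma> * x + 2 * \<gamma> * \<alpha> * y)"
proof -
  define \<sigma> where "\<sigma> = sgn (triple A B C)"
  have \<sigma>: "\<sigma>\<^sup>2 = 1" using V by (simp add: \<sigma>_def power2_eq_square sgn_if)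
  have rot: "{A, B, C} = {B, C, A}" "{A, B, C} = {C, A, B}" by auto
  have rt: "triple A B C = triple B C A" "triple A B C = triple C A B"
    by (metis triple_rotate)+
  have side: "0 \<le> \<sigma> * triple Q B C \<and> 0 \<le> \<sigma> * triple Q C A \<and> 0 \<le> \<sigma> * triple Q A B"
    if "Q \<in> convex_cone hull {A, B, C}" for Q
    using cone_hull_side[of Q A B C] cone_hull_side[of Q B C A] cone_hull_side[of Q C A B] that
    unfolding \<sigma>_def rt[symmetric] rot[symmetric] by simp
  have "\<sigma> * triple I B C = \<alpha> * S"
    using tangent_height[OF e I(1) ABC(2,3,4) sides(1,2) KS \<sigma> _ _ touch(1,2) cone_hull_edge[OF touch(3)]]
      side[OF I(2)] side disc by blast
  moreover have "\<sigma> * triple I C A = \<beta> * S"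
    using tangent_height[OF e I(1) ABC(3,1,5) sides(3,4) KS \<sigma> _ _ touch(4,5) cone_hull_edge[OF touch(6)]]
      side[OF I(2)] side disc by blast
  moreover have "\<sigma> * triple I A B = \<gamma> * S"
    using tangent_height[OF e I(1) ABC(1,2,6) sides(5,6) KS \<sigma> _ _ touch(7,8) cone_hull_edge[OF touch(9)]]
      side[OF I(2)] side disc by blast
  ultimately have "triple I B C = \<alpha> * (\<sigma> * S)" "triple I C A = \<beta> * (\<sigma> * S)" "triple I A B = \<gamma> * (\<sigma> * S)"
    using \<sigma> by algebra+
  from incentre_relation[OF e I(1) this ABC] show ?thesis
    using \<sigma> by (simp add: power_mult_distrib)
qed

text \<open>The equations of the circumcentre and of the incentre, rewritten with the half-angle values
  \<open>u = s a\<close>, \<open>v = s b\<close>, \<open>w = s c\<close>. The Gram determinant \<open>E\<close> of the chords is then \<open>4\<close> times Heron's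
  product for \<open>u, v, w\<close>, and it is positive because it is \<open>V2 / t\<^sup>2\<close>: the existence of the circumscribed
  circle yields the triangle inequalities for \<open>s a, s b, s c\<close>. In the hyperbolic plane these
  do not follow from the triangle inequalities for the sides.\<close>

lemma radii_relations:
  fixes e t K S u v w x y z V2 N m :: real
  assumes ee: "e * e = 1"
    and half: "1 - x = 2 * e * u\<^sup>2" "1 - y = 2 * e * v\<^sup>2" "1 - z = 2 * e * w\<^sup>2"
    and V2: "V2 > 0" "V2 = 1 + 2 * x * y * z - x\<^sup>2 - y\<^sup>2 - z\<^sup>2"
    and circ: "V2 = t\<^sup>2 * (4 * (1 - y) * (1 - z) - (1 + x - y - z)\<^sup>2)" "t \<noteq> 0" "t\<^sup>2 + e * q\<^sup>2 = 1"
    and inc: "V2 = S\<^sup>2 * N" "K \<noteq> 0" "K\<^sup>2 + e * S\<^sup>2 = 1" "N - e * V2 = 4 * m\<^sup>2"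
  shows "(u + v + w) * ((v + w - u) * (w + u - v) * (u + v - w)) > 0"
    and "(q / t)\<^sup>2 * V2 = 16 * (u * v * w)\<^sup>2"
    and "4 * (S / K)\<^sup>2 * m\<^sup>2 = V2"
proof -
  define E where "E = 4 * (1 - y) * (1 - z) - (1 + x - y - z)\<^sup>2"
  have xyz: "x = 1 - 2 * e * u\<^sup>2" "y = 1 - 2 * e * v\<^sup>2" "z = 1 - 2 * e * w\<^sup>2"
    using half by simp_all
  have E: "V2 = t\<^sup>2 * E" using circ(1) by (simp add: E_def)
  then have "E > 0" using V2(1) by (metis zero_less_mult_iff not_square_less_zero power2_eq_square)
  moreover have "E = 4 * ((u + v + w) * ((v + w - u) * (w + u - v) * (u + v - w)))"
    unfolding E_def xyz using ee by algebra
  ultimately show "(u + v + w) * ((v + w - u) * (w + u - v) * (u + v - w)) > 0" by linarith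
  have "e * (E - V2) = 16 * (u * v * w)\<^sup>2"
    unfolding V2(2) E_def xyz using ee by algebra
  moreover have "q\<^sup>2 * E = e * (E - V2)"
    using circ(3) ee unfolding E by algebra
  ultimately have "q\<^sup>2 * E = 16 * (u * v * w)\<^sup>2" by simp
  then show "(q / t)\<^sup>2 * V2 = 16 * (u * v * w)\<^sup>2"
    using circ(2) by (simp add: E power_divide)
  have "V2 * K\<^sup>2 = S\<^sup>2 * (4 * m\<^sup>2)"
    unfolding inc(4)[symmetric] using inc(1,3) ee by algebra
  then show "4 * (S / K)\<^sup>2 * m\<^sup>2 = V2"
    using inc(2) by (simp add: power_divide field_simps)
qed

text \<open>Two of three independent points never coincide and are never antipodal; this keeps the side
  lengths away from \<open>0\<close> and \<open>pi\<close>.\<close>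

lemma gram_positive_imp_distinct:
  fixes x y z :: real
  assumes "1 + 2 * x * y * z - x\<^sup>2 - y\<^sup>2 - z\<^sup>2 > 0"
  shows "x\<^sup>2 \<noteq> 1" "y\<^sup>2 \<noteq> 1" "z\<^sup>2 \<noteq> 1"
proof -
  have "\<not> (1 + 2 * x * y * z - x\<^sup>2 - y\<^sup>2 - z\<^sup>2 > 0)" if "x\<^sup>2 = 1" for x y z :: real
  proof -
    have "1 + 2 * x * y * z - x\<^sup>2 - y\<^sup>2 - z\<^sup>2 = - (y - x * z)\<^sup>2"
      using that by algebra
    then show ?thesis by simp
  qed
  note degenerate = this
  have "1 + 2 * y * z * x - y\<^sup>2 - z\<^sup>2 - x\<^sup>2 = 1 + 2 * x * y * z - x\<^sup>2 - y\<^sup>2 - z\<^sup>2"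
    "1 + 2 * z * x * y - z\<^sup>2 - x\<^sup>2 - y\<^sup>2 = 1 + 2 * x * y * z - x\<^sup>2 - y\<^sup>2 - z\<^sup>2"
    by algebra+
  then show "x\<^sup>2 \<noteq> 1" "y\<^sup>2 \<noteq> 1" "z\<^sup>2 \<noteq> 1"
    using degenerate[of x y z] degenerate[of y z x] degenerate[of z x y] assms by metis+
qed

section \<open>Half-angle identities\<close>

lemma quarter_sum_difference:
  fixes x y :: real
  shows "(x + y) / 2 / 2 + (x - y) / 2 / 2 = x / 2" "(x + y) / 2 / 2 - (x - y) / 2 / 2 = y / 2"
  by (simp_all add: field_simps)

lemma sin_product: "sin (x / 2) * sin (y / 2) = (sin ((x + y) / 2 / 2))\<^sup>2 - (sin ((x - y) / 2 / 2))\<^sup>2" for x y :: real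
proof -
  have "sin (p + q) * sin (p - q) = (sin p)\<^sup>2 - (sin q)\<^sup>2" for p q :: real
    using sin_cos_squared_add[of p] sin_cos_squared_add[of q] unfolding sin_add sin_diff by algebra
  from this[of "(x + y) / 2 / 2" "(x - y) / 2 / 2"] show ?thesis unfolding quarter_sum_difference .
qed

lemma sin_sum: "sin (x / 2) + sin (y / 2) = 2 * sin ((x + y) / 2 / 2) * cos ((x - y) / 2 / 2)" for x y :: real
proof -
  have "sin (p + q) + sin (p - q) = 2 * sin p * cos q" for p q :: real
    by (simp add: sin_add sin_diff)
  from this[of "(x + y) / 2 / 2" "(x - y) / 2 / 2"] show ?thesis unfolding quarter_sum_difference .
qed

lemma sin_heron:
  fixes a b c :: real
  shows "1 + 2 * cos a * cos b * cos c - (cos a)\<^sup>2 - (cos b)\<^sup>2 - (cos c)\<^sup>2 =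
    4 * sin ((a + b + c) / 2) * (sin ((b + c - a) / 2) * sin ((c + a - b) / 2) * sin ((a + b - c) / 2))"
proof -
  define p q r where "p = (b + c - a) / 2" "q = (c + a - b) / 2" "r = (a + b - c) / 2"
  have *: "a = q + r" "b = r + p" "c = p + q" "(a + b + c) / 2 = p + q + r"
    by (simp_all add: p_q_r_def field_simps)
  show ?thesis
    unfolding p_q_r_def[symmetric] *(4) unfolding *(1-3)
    using sin_cos_squared_add[of p] sin_cos_squared_add[of q] sin_cos_squared_add[of r]
    unfolding sin_add cos_add by algebra
qed

text \<open>The sum of squares and mixed products is the factor of \<open>S\<^sup>2\<close> in the incentre relation. It
  exceeds the Gram determinant by \<open>2 - 2 * cos (a + b + c)\<close>.\<close>

lemma sin_excess:
  fixes a b c :: real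
  shows "(sin a)\<^sup>2 + (sin b)\<^sup>2 + (sin c)\<^sup>2 + 2 * sin a * sin b * cos c + 2 * sin b * sin c * cos a
      + 2 * sin c * sin a * cos b
      - (1 + 2 * cos a * cos b * cos c - (cos a)\<^sup>2 - (cos b)\<^sup>2 - (cos c)\<^sup>2) = 4 * (sin ((a + b + c) / 2))\<^sup>2"
proof -
  have "4 * (sin ((a + b + c) / 2))\<^sup>2 = 2 - 2 * cos (a + b + c)"
    using cos_double_sin[of "(a + b + c) / 2"] by (simp del: distrib_left_numeral)
  then show ?thesis
    using sin_cos_squared_add[of a] sin_cos_squared_add[of b] sin_cos_squared_add[of c]
    unfolding sin_add cos_add by algebra
qed

lemma sinh_product: "sinh (x / 2) * sinh (y / 2) = (sinh ((x + y) / 2 / 2))\<^sup>2 - (sinh ((x - y) / 2 / 2))\<^sup>2" for x y :: real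
proof -
  have "sinh (p + q) * sinh (p - q) = (sinh p)\<^sup>2 - (sinh q)\<^sup>2" for p q :: real
    using cosh_square_eq[of p] cosh_square_eq[of q] unfolding sinh_add sinh_diff by algebra
  from this[of "(x + y) / 2 / 2" "(x - y) / 2 / 2"] show ?thesis unfolding quarter_sum_difference .
qed

lemma sinh_sum: "sinh (x / 2) + sinh (y / 2) = 2 * sinh ((x + y) / 2 / 2) * cosh ((x - y) / 2 / 2)" for x y :: real
proof -
  have "sinh (p + q) + sinh (p - q) = 2 * sinh p * cosh q" for p q :: real
    by (simp add: sinh_add sinh_diff)
  from this[of "(x + y) / 2 / 2" "(x - y) / 2 / 2"] show ?thesis unfolding quarter_sum_difference .
qed

lemma sinh_heron:
  fixes a b c :: real
  shows "1 + 2 * cosh a * cosh b * cosh c - (cosh a)\<^sup>2 - (cosh b)\<^sup>2 - (cosh c)\<^sup>2 =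
    4 * sinh ((a + b + c) / 2) * (sinh ((b + c - a) / 2) * sinh ((c + a - b) / 2) * sinh ((a + b - c) / 2))"
proof -
  define p q r where "p = (b + c - a) / 2" "q = (c + a - b) / 2" "r = (a + b - c) / 2"
  have *: "a = q + r" "b = r + p" "c = p + q" "(a + b + c) / 2 = p + q + r"
    by (simp_all add: p_q_r_def field_simps)
  show ?thesis
    unfolding p_q_r_def[symmetric] *(4) unfolding *(1-3)
    using cosh_square_eq[of p] cosh_square_eq[of q] cosh_square_eq[of r]
    unfolding sinh_add cosh_add by algebra
qed

lemma sinh_excess:
  fixes a b c :: real
  shows "(sinh a)\<^sup>2 + (sinh b)\<^sup>2 + (sinh c)\<^sup>2 + 2 * sinh a * sinh b * cosh c + 2 * sinh b * sinh c * cosh a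
      + 2 * sinh c * sinh a * cosh b
      + (1 + 2 * cosh a * cosh b * cosh c - (cosh a)\<^sup>2 - (cosh b)\<^sup>2 - (cosh c)\<^sup>2) = 4 * (sinh ((a + b + c) / 2))\<^sup>2"
proof -
  have "4 * (sinh ((a + b + c) / 2))\<^sup>2 = 2 * cosh (a + b + c) - 2"
    using cosh_double[of "(a + b + c) / 2"] cosh_square_eq[of "(a + b + c) / 2"] by (simp del: distrib_left_numeral) simp
  then show ?thesis
    using cosh_square_eq[of a] cosh_square_eq[of b] cosh_square_eq[of c]
    unfolding sinh_add cosh_add by algebra
qed

section \<open>Spherical triangles\<close>

lemma form_sphere: "X \<in> S2 \<longleftrightarrow> form 1 X X = 1"
  by (simp add: S2_def form_one norm_eq_1)

lemma cos_sdist: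
  assumes "x \<in> S2" "y \<in> S2"
  shows "cos (sdist x y) = form 1 x y" "\<bar>form 1 x y\<bar> \<le> 1"
proof -
  show "\<bar>form 1 x y\<bar> \<le> 1"
    using Cauchy_Schwarz_ineq2[of x y] assms by (simp add: S2_def form_one)
  then show "cos (sdist x y) = form 1 x y"
    by (simp add: sdist_def form_one cos_arccos_abs)
qed

lemma spherical_case:
  assumes ABC: "A \<in> S2" "B \<in> S2" "C \<in> S2" and nondeg: "\<nexists>G. great_circle G \<and> {A, B, C} \<subseteq> G"
    and sides: "a = sdist B C" "b = sdist C A" "c = sdist A B"
    and circ: "circumradius S2 sdist A B C R" "R < pi / 2"
    and inc: "inradius S2 sdist shull A B C r" "r < pi / 2"
  shows "tan R / tan r \<ge> mean_ratio (\<lambda>x. sin (x / 2)) a b c \<and>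
       mean_ratio (\<lambda>x. sin (x / 2)) a b c \<ge> 2 \<and>
       (tan R / tan r = mean_ratio (\<lambda>x. sin (x / 2)) a b c \<longleftrightarrow> a = b \<and> b = c) \<and>
       (mean_ratio (\<lambda>x. sin (x / 2)) a b c = 2 \<longleftrightarrow> a = b \<and> b = c)"
proof -
  have e: "(1::real) = 1 \<or> (1::real) = -1" by simp
  have V0: "triple A B C \<noteq> 0"
  proof
    assume "triple A B C = 0"
    then obtain n where n: "n \<noteq> 0" "n \<bullet> A = 0" "n \<bullet> B = 0" "n \<bullet> C = 0"
      by (rule coplanar_if_triple_zero)
    then have "great_circle (S2 \<inter> {x. n \<bullet> x = 0})" by (auto simp: great_circle_def)
    with nondeg n ABC show False by blast
  qed
  have cosines: "form 1 B C = 1 * cos a" "form 1 C A = 1 * cos b" "form 1 A B = 1 * cos c"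
    by (simp_all add: sides cos_sdist ABC)
  obtain P where P: "P \<in> S2" "sdist P A = R" "sdist P B = R" "sdist P C = R" and R: "R > 0"
    using circ(1) by (auto simp: circumradius_def)
  have PP: "form 1 P A = 1 * cos R" "form 1 P B = 1 * cos R" "form 1 P C = 1 * cos R"
    using cos_sdist(1)[OF P(1) ABC(1)] cos_sdist(1)[OF P(1) ABC(2)] cos_sdist(1)[OF P(1) ABC(3)] P(2-4)
    by simp_all
  note norms = ABC[unfolded form_sphere]
  note CR = circumcentre_relation[OF e P(1)[unfolded form_sphere] PP norms cosines]
  have V2: "(triple A B C)\<^sup>2 > 0" using V0 by simp
  have range: "0 < p \<and> p < pi" if "p = sdist X Y" "X \<in> S2" "Y \<in> S2" "(cos p)\<^sup>2 \<noteq> 1" for p X Y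
  proof -
    have "\<bar>X \<bullet> Y\<bar> \<le> 1" "(X \<bullet> Y)\<^sup>2 \<noteq> 1" using that cos_sdist[of X Y] by (auto simp: form_one)
    then have "\<bar>X \<bullet> Y\<bar> \<noteq> 1" by (metis power2_abs power_one)
    with \<open>\<bar>X \<bullet> Y\<bar> \<le> 1\<close> have "-1 < X \<bullet> Y" "X \<bullet> Y < 1" by auto
    then show ?thesis using arccos_lt_bounded that(1) by (simp add: sdist_def)
  qed
  have abc: "0 < a" "a < pi" "0 < b" "b < pi" "0 < c" "c < pi"
    using gram_positive_imp_distinct[OF V2[unfolded CR(2)]] range[OF sides(1)] range[OF sides(2)] range[OF sides(3)] ABC by auto
  obtain I where r: "r > 0" and I: "I \<in> S2" and disc: "{Q \<in> S2. sdist I Q \<le> r} \<subseteq> shull {A, B, C}"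
    and "\<exists>Q\<in>shull {B, C}. sdist I Q = r" "\<exists>Q\<in>shull {C, A}. sdist I Q = r" "\<exists>Q\<in>shull {A, B}. sdist I Q = r"
    using inc(1) by (auto simp: inradius_def)
  then obtain Qa Qb Qc where touch: "Qa \<in> shull {B, C}" "sdist I Qa = r"
    "Qb \<in> shull {C, A}" "sdist I Qb = r" "Qc \<in> shull {A, B}" "sdist I Qc = r" by blast
  have onS: "form 1 Q Q = 1 \<and> form 1 I Q = 1 * cos r \<and> Q \<in> convex_cone hull W"
    if "Q \<in> shull W" "sdist I Q = r" for Q W
    using that cos_sdist(1)[OF I, of Q] by (auto simp: shull_def form_sphere)
  have "sdist I I = 0" using I by (simp add: sdist_def S2_def dot_square_norm)
  then have Ihull: "I \<in> convex_cone hull {A, B, C}" using disc I r by (auto simp: shull_def)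
  have discQ: "Q \<in> convex_cone hull {A, B, C}" if "form 1 Q Q = 1" "form 1 I Q = 1 * cos r" for Q
  proof -
    have "sdist I Q = r" using that r inc(2) by (simp add: sdist_def form_one arccos_cos)
    with that(1) disc show ?thesis by (auto simp: form_sphere shull_def)
  qed
  have pos: "cos r > 0" "sin r > 0" "cos R > 0" "sin R > 0"
    using r R circ(2) inc(2) by (auto intro!: cos_gt_zero sin_gt_zero2)
  have sq: "(sin p)\<^sup>2 = 1 * (1 - (cos p)\<^sup>2)" "(cos p)\<^sup>2 + 1 * (sin p)\<^sup>2 = 1"
    "1 - cos p = 2 * 1 * (sin (p / 2))\<^sup>2" for p :: real
    using cos_double_sin[of "p / 2"] by (simp_all add: sin_squared_eq)
  have sinpos: "sin a > 0" "sin b > 0" "sin c > 0" using abc by (simp_all add: sin_gt_zero)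
  have touching: "form 1 Qa Qa = 1" "form 1 I Qa = 1 * cos r" "Qa \<in> convex_cone hull {B, C}"
    "form 1 Qb Qb = 1" "form 1 I Qb = 1 * cos r" "Qb \<in> convex_cone hull {C, A}"
    "form 1 Qc Qc = 1" "form 1 I Qc = 1 * cos r" "Qc \<in> convex_cone hull {A, B}"
    using onS[OF touch(1,2)] onS[OF touch(3,4)] onS[OF touch(5,6)] by blast+
  have IR: "(triple A B C)\<^sup>2 = (sin r)\<^sup>2 * ((sin a)\<^sup>2 + (sin b)\<^sup>2 + (sin c)\<^sup>2 + 2 * sin a * sin b * cos c
     + 2 * sin b * sin c * cos a + 2 * sin c * sin a * cos b)"
    by (rule inscribed_circle_relation[OF e norms cosines V0 sinpos(1) sq(1) sinpos(2) sq(1) sinpos(3) sq(1)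
      pos(1,2) sq(2) I[unfolded form_sphere] Ihull discQ touching])
  have exc: "(sin a)\<^sup>2 + (sin b)\<^sup>2 + (sin c)\<^sup>2 + 2 * sin a * sin b * cos c
     + 2 * sin b * sin c * cos a + 2 * sin c * sin a * cos b - 1 * (triple A B C)\<^sup>2 = 4 * (sin ((a + b + c) / 2))\<^sup>2"
    using sin_excess[of a b c] CR(2) by simp
  have chord: "(sin (a / 2) + sin (b / 2) + sin (c / 2)) * ((sin (b / 2) + sin (c / 2) - sin (a / 2))
      * (sin (c / 2) + sin (a / 2) - sin (b / 2)) * (sin (a / 2) + sin (b / 2) - sin (c / 2))) > 0"
    and TR: "(sin R / cos R)\<^sup>2 * (triple A B C)\<^sup>2 = 16 * (sin (a / 2) * sin (b / 2) * sin (c / 2))\<^sup>2"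
    and Tr: "4 * (sin r / cos r)\<^sup>2 * (sin ((a + b + c) / 2))\<^sup>2 = (triple A B C)\<^sup>2"
    by (rule radii_relations[OF _ sq(3) sq(3) sq(3) V2 CR(2) CR(1) _ sq(2) IR _ sq(2) exc]; use pos in simp)+
  have heron: "(triple A B C)\<^sup>2 = 4 * sin ((a + b + c) / 2) *
      (sin ((b + c - a) / 2) * sin ((c + a - b) / 2) * sin ((a + b - c) / 2))"
    unfolding CR(2) by (rule sin_heron)
  let ?X = "sin ((b + c - a) / 2)" and ?Y = "sin ((c + a - b) / 2)" and ?Z = "sin ((a + b - c) / 2)"
  \<comment> \<open>If the perimeter were at least \<open>2 * pi\<close>, only the first factor in Heron's formula would be
    nonpositive, against the nondegeneracy of the triangle.\<close>
  have perimeter: "a + b + c < 2 * pi"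
  proof (rule ccontr)
    assume "\<not> a + b + c < 2 * pi"
    then have "?X > 0" "?Y > 0" "?Z > 0" "sin ((a + b + c) / 2) \<le> 0"
      using abc sin_le_zero[of "(a + b + c) / 2"] by (auto intro!: sin_gt_zero)
    then have "(triple A B C)\<^sup>2 \<le> 0" unfolding heron by (simp add: mult_nonpos_nonneg)
    with V2 show False by simp
  qed
  then have s0: "sin ((a + b + c) / 2) > 0" using abc by (intro sin_gt_zero) auto
  then have prodXYZ: "?X * ?Y * ?Z > 0"
    using V2 unfolding heron by (simp add: zero_less_mult_iff)
  have spos: "sin (t / 2) > 0" if "0 < t" "t < 2 * pi" for t :: real
    using that by (intro sin_gt_zero) auto
  have "?X > 0 \<or> ?Y > 0" "?Y > 0 \<or> ?Z > 0" "?X > 0 \<or> ?Z > 0"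
    using spos[of "b + c - a"] spos[of "c + a - b"] spos[of "a + b - c"] abc by linarith+
  with prodXYZ have XYZ: "?X > 0" "?Y > 0" "?Z > 0" by (rule three_positive_factors)+
  have mean: "sin ((p + q) / 2 / 2) > 0" if "0 < p" "p < pi" "0 < q" "q < pi" for p q :: real
    using that by (intro spos) auto
  have zero: "sin ((p - q) / 2 / 2) = 0 \<longleftrightarrow> p = q" if "0 < p" "p < pi" "0 < q" "q < pi" for p q :: real
    using that sin_eq_0_pi[of "(p - q) / 2 / 2"] by auto
  show ?thesis
  proof (rule mean_ratio_bounds[where s = "\<lambda>x. sin (x / 2)" and k = "\<lambda>x. cos (x / 2)"
        and a = a and b = b and c = c and D = "(triple A B C)\<^sup>2" and T = "tan R" and t = "tan r"])
    show "sin (2 * x / 2) = 2 * sin (x / 2) * cos (x / 2)" for x :: real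
      using sin_double[of "x / 2"] by simp
    show "(tan R)\<^sup>2 * (triple A B C)\<^sup>2 = 16 * (sin (a / 2) * sin (b / 2) * sin (c / 2))\<^sup>2"
      "4 * (tan r)\<^sup>2 * (sin ((a + b + c) / 2))\<^sup>2 = (triple A B C)\<^sup>2"
      unfolding tan_def by (rule TR Tr)+
    show "0 < sin (a / 2)" "0 < sin (b / 2)" "0 < sin (c / 2)" "0 < sin ((a + b) / 2 / 2)"
      "0 < sin ((b + c) / 2 / 2)" "0 < sin ((a + c) / 2 / 2)"
      using spos[of a] spos[of b] spos[of c] mean[of a b] mean[of b c] mean[of a c] abc by simp_all
    show "(sin ((a - b) / 2 / 2) = 0) = (a = b)" "(sin ((b - c) / 2 / 2) = 0) = (b = c)" "(sin ((c - a) / 2 / 2) = 0) = (c = a)"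
      using zero abc by blast+
    show "0 < tan R" "0 < tan r" using pos by (simp_all add: tan_def)
  qed (fact sin_product sin_sum chord heron s0 XYZ)+
qed

section \<open>Hyperbolic triangles\<close>

lemma form_H2: "X \<in> H2 \<longleftrightarrow> form (-1) X X = -1 \<and> X$3 > 0"
  by (simp add: H2_def form_minus_one)

text \<open>Euclidean Cauchy-Schwarz for the vectors \<open>(1, x$1, x$2)\<close> and \<open>(1, y$1, y$2)\<close>, whose lengths are
  \<open>x$3\<close> and \<open>y$3\<close>.\<close>

lemma reversed_Cauchy_Schwarz:
  assumes "x \<in> H2" "y \<in> H2"
  shows "form (-1) x y \<le> -1"
proof -
  have x: "(x$3)\<^sup>2 = 1 + (x$1)\<^sup>2 + (x$2)\<^sup>2" "x$3 > 0" and y: "(y$3)\<^sup>2 = 1 + (y$1)\<^sup>2 + (y$2)\<^sup>2" "y$3 > 0"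
    using assms by (auto simp: form_H2 form_def power2_eq_square)
  have "(x$3 * y$3)\<^sup>2 - (1 + x$1 * y$1 + x$2 * y$2)\<^sup>2
      = (x$1 - y$1)\<^sup>2 + (x$2 - y$2)\<^sup>2 + (x$1 * y$2 - x$2 * y$1)\<^sup>2"
    using x(1) y(1) by algebra
  then have "(1 + x$1 * y$1 + x$2 * y$2)\<^sup>2 \<le> (x$3 * y$3)\<^sup>2"
    by (smt (verit) zero_le_power2)
  then have "1 + x$1 * y$1 + x$2 * y$2 \<le> x$3 * y$3"
    by (rule power2_le_imp_le) (use x y in simp)
  then show ?thesis by (simp add: form_def)
qed

text \<open>The tangency argument produces points by vector algebra; this is what places them on the
  upper sheet rather than on the lower one.\<close>

lemma upper_sheet:
  assumes "x \<in> H2" "form (-1) y y = -1" "form (-1) x y < 0"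
  shows "y \<in> H2"
proof (rule ccontr)
  assume "y \<notin> H2"
  moreover have "y$3 \<noteq> 0"
  proof
    assume "y$3 = 0"
    then have "form (-1) y y = (y$1)\<^sup>2 + (y$2)\<^sup>2" by (simp add: form_def power2_eq_square)
    with assms(2) show False by (smt (verit) zero_le_power2)
  qed
  ultimately have "- y \<in> H2" using assms(2) by (auto simp: form_H2 form_def)
  from reversed_Cauchy_Schwarz[OF assms(1) this] assms(3) show False by (simp add: form_def)
qed

lemma cosh_hdist:
  assumes "x \<in> H2" "y \<in> H2"
  shows "form (-1) x y = (-1) * cosh (hdist x y)" "hdist x y \<ge> 0"
  using reversed_Cauchy_Schwarz[OF assms] by (simp_all add: hdist_def form_minus_one)

lemma hyperbolic_case:
  assumes ABC: "A \<in> H2" "B \<in> H2" "C \<in> H2" and nondeg: "\<nexists>L. hyperbolic_line L \<and> {A, B, C} \<subseteq> L"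
    and sides: "a = hdist B C" "b = hdist C A" "c = hdist A B"
    and circ: "circumradius H2 hdist A B C R"
    and inc: "inradius H2 hdist hhull A B C r"
  shows "tanh R / tanh r \<ge> mean_ratio (\<lambda>x. sinh (x / 2)) a b c \<and>
       mean_ratio (\<lambda>x. sinh (x / 2)) a b c \<ge> 2 \<and>
       (tanh R / tanh r = mean_ratio (\<lambda>x. sinh (x / 2)) a b c \<longleftrightarrow> a = b \<and> b = c) \<and>
       (mean_ratio (\<lambda>x. sinh (x / 2)) a b c = 2 \<longleftrightarrow> a = b \<and> b = c)"
proof -
  have e: "(-1::real) = 1 \<or> (-1::real) = -1" by simp
  have V0: "triple A B C \<noteq> 0"
  proof
    assume "triple A B C = 0"
    then obtain n where n: "n \<noteq> 0" "n \<bullet> A = 0" "n \<bullet> B = 0" "n \<bullet> C = 0"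
      by (rule coplanar_if_triple_zero)
    with ABC have "hyperbolic_line (H2 \<inter> {x. n \<bullet> x = 0})" by (auto simp: hyperbolic_line_def)
    with nondeg n ABC show False by blast
  qed
  have cosines: "form (-1) B C = (-1) * cosh a" "form (-1) C A = (-1) * cosh b" "form (-1) A B = (-1) * cosh c"
    unfolding sides by (intro cosh_hdist ABC)+
  obtain P where P: "P \<in> H2" "hdist P A = R" "hdist P B = R" "hdist P C = R" and R: "R > 0"
    using circ by (auto simp: circumradius_def)
  have PP: "form (-1) P A = (-1) * cosh R" "form (-1) P B = (-1) * cosh R" "form (-1) P C = (-1) * cosh R"
    using cosh_hdist(1)[OF P(1) ABC(1)] cosh_hdist(1)[OF P(1) ABC(2)] cosh_hdist(1)[OF P(1) ABC(3)] P(2-4)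
    by simp_all
  have norm: "form (-1) X X = -1" if "X \<in> H2" for X using that by (simp add: form_H2)
  note norms = ABC[THEN norm]
  note CR = circumcentre_relation[OF e norm[OF P(1)] PP norms cosines]
  have V2: "(triple A B C)\<^sup>2 > 0" using V0 by simp
  have "(cosh a)\<^sup>2 \<noteq> 1" "(cosh b)\<^sup>2 \<noteq> 1" "(cosh c)\<^sup>2 \<noteq> 1"
    using gram_positive_imp_distinct[OF V2[unfolded CR(2)]] by auto
  moreover have "a \<ge> 0" "b \<ge> 0" "c \<ge> 0" unfolding sides by (intro cosh_hdist ABC)+
  ultimately have abc: "0 < a" "0 < b" "0 < c"
    by (auto simp: cosh_square_eq)
  obtain I where r: "r > 0" and I: "I \<in> H2" and disc: "{Q \<in> H2. hdist I Q \<le> r} \<subseteq> hhull {A, B, C}"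
    and "\<exists>Q\<in>hhull {B, C}. hdist I Q = r" "\<exists>Q\<in>hhull {C, A}. hdist I Q = r" "\<exists>Q\<in>hhull {A, B}. hdist I Q = r"
    using inc by (auto simp: inradius_def)
  then obtain Qa Qb Qc where touch: "Qa \<in> hhull {B, C}" "hdist I Qa = r"
    "Qb \<in> hhull {C, A}" "hdist I Qb = r" "Qc \<in> hhull {A, B}" "hdist I Qc = r" by blast
  have onH: "form (-1) Q Q = -1 \<and> form (-1) I Q = (-1) * cosh r \<and> Q \<in> convex_cone hull W"
    if "Q \<in> hhull W" "hdist I Q = r" for Q W
    using that cosh_hdist(1)[OF I, of Q] norm[of Q] by (auto simp: hhull_def)
  have "hdist I I = 0" using I by (simp add: hdist_def H2_def)
  then have Ihull: "I \<in> convex_cone hull {A, B, C}" using disc I r by (auto simp: hhull_def)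
  have discQ: "Q \<in> convex_cone hull {A, B, C}" if "form (-1) Q Q = -1" "form (-1) I Q = (-1) * cosh r" for Q
  proof -
    have "Q \<in> H2" using upper_sheet[OF I that(1)] that(2) by simp
    moreover have "hdist I Q = r" using that(2) r by (simp add: hdist_def form_minus_one arcosh_cosh_real)
    ultimately show ?thesis using disc by (auto simp: hhull_def)
  qed
  have sq: "(sinh p)\<^sup>2 = -1 * (1 - (cosh p)\<^sup>2)" "(cosh p)\<^sup>2 + -1 * (sinh p)\<^sup>2 = 1"
    "1 - cosh p = 2 * -1 * (sinh (p / 2))\<^sup>2" for p :: real
  proof -
    show "(sinh p)\<^sup>2 = -1 * (1 - (cosh p)\<^sup>2)" "(cosh p)\<^sup>2 + -1 * (sinh p)\<^sup>2 = 1"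
      by (simp_all add: cosh_square_eq)
    have "cosh p = (cosh (p / 2))\<^sup>2 + (sinh (p / 2))\<^sup>2" using cosh_double[of "p / 2"] by simp
    then show "1 - cosh p = 2 * -1 * (sinh (p / 2))\<^sup>2" by (simp add: cosh_square_eq)
  qed
  have pos: "cosh r > 0" "sinh r > 0" "sinh a > 0" "sinh b > 0" "sinh c > 0" using r abc by simp_all
  have touching: "form (-1) Qa Qa = -1" "form (-1) I Qa = (-1) * cosh r" "Qa \<in> convex_cone hull {B, C}"
    "form (-1) Qb Qb = -1" "form (-1) I Qb = (-1) * cosh r" "Qb \<in> convex_cone hull {C, A}"
    "form (-1) Qc Qc = -1" "form (-1) I Qc = (-1) * cosh r" "Qc \<in> convex_cone hull {A, B}"
    using onH[OF touch(1,2)] onH[OF touch(3,4)] onH[OF touch(5,6)] by blast+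
  have IR: "(triple A B C)\<^sup>2 = (sinh r)\<^sup>2 * ((sinh a)\<^sup>2 + (sinh b)\<^sup>2 + (sinh c)\<^sup>2 + 2 * sinh a * sinh b * cosh c
     + 2 * sinh b * sinh c * cosh a + 2 * sinh c * sinh a * cosh b)"
    by (rule inscribed_circle_relation[OF e norms cosines V0 pos(3) sq(1) pos(4) sq(1) pos(5) sq(1)
      pos(1,2) sq(2) norm[OF I] Ihull discQ touching])
  have exc: "(sinh a)\<^sup>2 + (sinh b)\<^sup>2 + (sinh c)\<^sup>2 + 2 * sinh a * sinh b * cosh c
     + 2 * sinh b * sinh c * cosh a + 2 * sinh c * sinh a * cosh b - -1 * (triple A B C)\<^sup>2 = 4 * (sinh ((a + b + c) / 2))\<^sup>2"
    using sinh_excess[of a b c] CR(2) by simp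
  have chord: "(sinh (a / 2) + sinh (b / 2) + sinh (c / 2)) * ((sinh (b / 2) + sinh (c / 2) - sinh (a / 2))
      * (sinh (c / 2) + sinh (a / 2) - sinh (b / 2)) * (sinh (a / 2) + sinh (b / 2) - sinh (c / 2))) > 0"
    and TR: "(sinh R / cosh R)\<^sup>2 * (triple A B C)\<^sup>2 = 16 * (sinh (a / 2) * sinh (b / 2) * sinh (c / 2))\<^sup>2"
    and Tr: "4 * (sinh r / cosh r)\<^sup>2 * (sinh ((a + b + c) / 2))\<^sup>2 = (triple A B C)\<^sup>2"
    by (rule radii_relations[OF _ sq(3) sq(3) sq(3) V2 CR(2) CR(1) _ sq(2) IR _ sq(2) exc]; use pos in simp)+
  have heron: "(triple A B C)\<^sup>2 = 4 * sinh ((a + b + c) / 2) *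
      (sinh ((b + c - a) / 2) * sinh ((c + a - b) / 2) * sinh ((a + b - c) / 2))"
    unfolding CR(2) by (rule sinh_heron)
  let ?X = "sinh ((b + c - a) / 2)" and ?Y = "sinh ((c + a - b) / 2)" and ?Z = "sinh ((a + b - c) / 2)"
  have s0: "sinh ((a + b + c) / 2) > 0" using abc by simp
  then have "?X * ?Y * ?Z > 0"
    using V2 unfolding heron by (simp add: zero_less_mult_iff)
  moreover have "?X > 0 \<or> ?Y > 0" "?Y > 0 \<or> ?Z > 0" "?X > 0 \<or> ?Z > 0"
    unfolding sinh_real_pos_iff half_gt_zero_iff using abc by linarith+
  ultimately have XYZ: "?X > 0" "?Y > 0" "?Z > 0" by (rule three_positive_factors)+
  show ?thesis
  proof (rule mean_ratio_bounds[where s = "\<lambda>x. sinh (x / 2)" and k = "\<lambda>x. cosh (x / 2)"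
        and a = a and b = b and c = c and D = "(triple A B C)\<^sup>2" and T = "tanh R" and t = "tanh r"])
    show "sinh (2 * x / 2) = 2 * sinh (x / 2) * cosh (x / 2)" for x :: real
      using sinh_double[of "x / 2"] by simp
    show "(tanh R)\<^sup>2 * (triple A B C)\<^sup>2 = 16 * (sinh (a / 2) * sinh (b / 2) * sinh (c / 2))\<^sup>2"
      "4 * (tanh r)\<^sup>2 * (sinh ((a + b + c) / 2))\<^sup>2 = (triple A B C)\<^sup>2"
      unfolding tanh_def by (rule TR Tr)+
    show "0 < sinh (a / 2)" "0 < sinh (b / 2)" "0 < sinh (c / 2)" "0 < sinh ((a + b) / 2 / 2)"
      "0 < sinh ((b + c) / 2 / 2)" "0 < sinh ((a + c) / 2 / 2)"
      using abc by simp_all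
    show "(sinh ((a - b) / 2 / 2) = 0) = (a = b)" "(sinh ((b - c) / 2 / 2) = 0) = (b = c)" "(sinh ((c - a) / 2 / 2) = 0) = (c = a)"
      by simp_all
    show "0 < tanh R" "0 < tanh r" using R r by simp_all
  qed (fact sinh_product sinh_sum chord heron s0 XYZ)+
qed

section \<open>Euclidean triangles\<close>

text \<open>Twice the signed area of the triangle \<open>X Y Z\<close>; as a function of \<open>X\<close> it is affine, and it plays
  the part of \<open>triple\<close> on the other two surfaces.\<close>

definition signed_area2 :: "real^2 \<Rightarrow> real^2 \<Rightarrow> real^2 \<Rightarrow> real" where
  "signed_area2 X Y Z = (Y$1 - X$1) * (Z$2 - X$2) - (Y$2 - X$2) * (Z$1 - X$1)"

lemma dist_plane: "(dist X Y)\<^sup>2 = (X$1 - Y$1)\<^sup>2 + (X$2 - Y$2)\<^sup>2" for X Y :: "real^2"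
  unfolding dist_norm power2_norm_eq_inner by (simp add: inner_vec_def sum_2 power2_eq_square)

lemma collinear_if_area_zero:
  assumes "signed_area2 A B C = 0"
  shows "collinear {A, B, C}"
proof -
  let ?u = "B - A" and ?v = "C - A"
  have "(?u \<bullet> ?v)\<^sup>2 + (signed_area2 A B C)\<^sup>2 = (norm ?u)\<^sup>2 * (norm ?v)\<^sup>2"
    unfolding power2_norm_eq_inner inner_vec_def sum_2 signed_area2_def by simp algebra
  then have "\<bar>?u \<bullet> ?v\<bar>\<^sup>2 = (norm ?u * norm ?v)\<^sup>2"
    using assms by (simp add: power_mult_distrib)
  then have "\<bar>?u \<bullet> ?v\<bar> = norm ?u * norm ?v"
    by (rule power2_eq_imp_eq) simp_all
  then have "collinear {0, ?u, ?v}" by (simp add: norm_cauchy_schwarz_equal)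
  then have "collinear {B, A, C}" by (subst collinear_3) auto
  then show ?thesis by (simp add: insert_commute)
qed

text \<open>The boundary point of the disc in the direction of the outer normal must still lie on the
  inner side of the line \<open>BC\<close>, so the height of \<open>I\<close> is at least \<open>r\<close>; the common point \<open>Q\<close> of the
  circle and the line shows that it is at most \<open>r\<close>. The normal \<open>n\<close> below has length \<open>a\<close>.\<close>

lemma plane_tangent_height:
  fixes I B C Q :: "real^2"
  assumes \<sigma>: "\<sigma>\<^sup>2 = 1" and r: "r > 0" and a: "a = dist B C" "a > 0"
    and disc: "\<And>X. dist I X \<le> r \<Longrightarrow> 0 \<le> \<sigma> * signed_area2 X B C"
    and Q: "dist I Q = r" "signed_area2 Q B C = 0"
  shows "\<sigma> * signed_area2 I B C = a * r"
proof -
  define n :: "real^2" where "n = vector [B$2 - C$2, C$1 - B$1]"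
  have "(norm n)\<^sup>2 = a\<^sup>2"
    unfolding a(1) dist_plane power2_norm_eq_inner
    by (simp add: n_def inner_vec_def sum_2 power2_eq_square algebra_simps)
  then have n: "norm n = a" using a(2) by (simp add: power2_eq_iff_nonneg)
  have move: "signed_area2 (I + v) B C = signed_area2 I B C + n \<bullet> v" for v
    by (simp add: signed_area2_def n_def inner_vec_def sum_2 algebra_simps)
  define v where "v = - (\<sigma> * r / a) *\<^sub>R n"
  have s: "\<bar>\<sigma>\<bar> = 1" using \<sigma> by (metis abs_1 power2_eq_iff abs_minus_cancel one_power2)
  have s2: "\<sigma> * \<sigma> = 1" using \<sigma> by (simp add: power2_eq_square)
  then have ss: "\<sigma> * (\<sigma> * (a * r)) = a * r" by (simp add: mult.assoc[symmetric])
  have "norm v = r" using n a(2) r s by (simp add: v_def abs_mult)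
  then have "0 \<le> \<sigma> * signed_area2 (I + v) B C" by (intro disc) (simp add: dist_norm)
  moreover have "n \<bullet> v = - \<sigma> * (r * a)"
    using a(2) n by (simp add: v_def dot_square_norm power2_eq_square)
  ultimately have 1: "a * r \<le> \<sigma> * signed_area2 I B C"
    using ss by (simp add: move algebra_simps)
  have "signed_area2 I B C = - (n \<bullet> (Q - I))" using move[of "Q - I"] Q(2) by simp
  then have "\<bar>\<sigma> * signed_area2 I B C\<bar> \<le> a * r"
    using Cauchy_Schwarz_ineq2[of n "Q - I"] n Q(1) s by (simp add: abs_mult dist_norm norm_minus_commute)
  with 1 show ?thesis by linarith
qed

lemma area_convex: "convex {X. 0 \<le> k * signed_area2 X B C}"
proof -
  have "{X. 0 \<le> k * signed_area2 X B C} =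
      {X. (k *\<^sub>R vector [B$2 - C$2, C$1 - B$1]) \<bullet> X \<ge> - k * (B$1 * C$2 - B$2 * C$1)}"
    by (auto simp: signed_area2_def inner_vec_def sum_2 algebra_simps)
  then show ?thesis by (simp only: convex_halfspace_ge)
qed

lemma triangle_side:
  assumes "Q \<in> convex hull {A, B, C}"
  shows "0 \<le> sgn (signed_area2 A B C) * signed_area2 Q B C"
proof -
  have "convex hull {A, B, C} \<subseteq> {X. 0 \<le> sgn (signed_area2 A B C) * signed_area2 X B C}"
  proof (rule hull_minimal)
    have "signed_area2 B B C = 0" "signed_area2 C B C = 0" by (simp_all add: signed_area2_def)
    then show "{A, B, C} \<subseteq> {X. 0 \<le> sgn (signed_area2 A B C) * signed_area2 X B C}"
      by (simp add: sgn_if)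
  qed (rule area_convex)
  with assms show ?thesis by auto
qed

lemma triangle_edge:
  assumes "Q \<in> convex hull {B, C}"
  shows "signed_area2 Q B C = 0"
proof -
  obtain u v where "u + v = 1" and Q: "Q = u *\<^sub>R B + v *\<^sub>R C"
    using assms by (auto simp: convex_hull_2)
  then have "u = 1 - v" by simp
  show ?thesis
    unfolding Q signed_area2_def \<open>u = 1 - v\<close> by (simp add: algebra_simps)
qed

lemma euclidean_case:
  fixes A B C :: "real^2"
  assumes nondeg: "\<not> collinear {A, B, C}"
    and sides: "a = dist B C" "b = dist C A" "c = dist A B"
    and circ: "circumradius UNIV dist A B C R"
    and inc: "inradius UNIV dist (\<lambda>V. convex hull V) A B C r"
  shows "R / r \<ge> mean_ratio (\<lambda>x. x / 2) a b c \<and>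
       mean_ratio (\<lambda>x. x / 2) a b c \<ge> 2 \<and>
       (R / r = mean_ratio (\<lambda>x. x / 2) a b c \<longleftrightarrow> a = b \<and> b = c) \<and>
       (mean_ratio (\<lambda>x. x / 2) a b c = 2 \<longleftrightarrow> a = b \<and> b = c)"
proof -
  define W where "W = signed_area2 A B C"
  have W0: "W \<noteq> 0" using nondeg collinear_if_area_zero by (auto simp: W_def)
  have abc: "a > 0" "b > 0" "c > 0"
    using nondeg unfolding sides by (auto simp: insert_commute)
  have heron16: "4 * W\<^sup>2 = (a + b + c) * ((b + c - a) * (c + a - b) * (a + b - c))"
  proof -
    have "4 * W\<^sup>2 = 4 * b\<^sup>2 * c\<^sup>2 - (b\<^sup>2 + c\<^sup>2 - a\<^sup>2)\<^sup>2"
      unfolding sides dist_plane W_def signed_area2_def by algebra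
    then show ?thesis by algebra
  qed
  obtain P where P: "dist P A = R" "dist P B = R" "dist P C = R" and R: "R > 0"
    using circ by (auto simp: circumradius_def)
  have circ2: "4 * R\<^sup>2 * W\<^sup>2 = a\<^sup>2 * b\<^sup>2 * c\<^sup>2"
  proof -
    \<comment> \<open>The three vectors from the circumcentre to the vertices lie in a plane, so their Gram
      determinant vanishes.\<close>
    define u where "u = A - P" define v where "v = B - P" define w where "w = C - P"
    have norms: "u \<bullet> u = R\<^sup>2" "v \<bullet> v = R\<^sup>2" "w \<bullet> w = R\<^sup>2"
      unfolding power2_norm_eq_inner[symmetric] u_def v_def w_def
      using P by (simp_all add: dist_norm norm_minus_commute)
    have "a = norm (v - w)" "b = norm (w - u)" "c = norm (u - v)"
      by (simp_all add: sides u_def v_def w_def dist_norm)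
    then have dots: "2 * (v \<bullet> w) = 2 * R\<^sup>2 - a\<^sup>2" "2 * (w \<bullet> u) = 2 * R\<^sup>2 - b\<^sup>2" "2 * (u \<bullet> v) = 2 * R\<^sup>2 - c\<^sup>2"
      using norms by (simp_all add: power2_norm_eq_inner inner_diff inner_commute)
    have "(u \<bullet> u) * (v \<bullet> v) * (w \<bullet> w) + 2 * (u \<bullet> v) * (v \<bullet> w) * (w \<bullet> u)
        - (u \<bullet> u) * (v \<bullet> w)\<^sup>2 - (v \<bullet> v) * (w \<bullet> u)\<^sup>2 - (w \<bullet> w) * (u \<bullet> v)\<^sup>2 = 0"
      unfolding inner_vec_def sum_2 inner_real_def by algebra
    then have "a\<^sup>2 * b\<^sup>2 * c\<^sup>2 = R\<^sup>2 * (4 * b\<^sup>2 * c\<^sup>2 - (b\<^sup>2 + c\<^sup>2 - a\<^sup>2)\<^sup>2)"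
      unfolding norms using dots by algebra
    also have "\<dots> = R\<^sup>2 * (4 * W\<^sup>2)" unfolding heron16 by algebra
    finally show ?thesis by simp
  qed
  obtain I where r: "r > 0" and disc: "{Q. dist I Q \<le> r} \<subseteq> convex hull {A, B, C}"
    and "\<exists>Q\<in>convex hull {B, C}. dist I Q = r" "\<exists>Q\<in>convex hull {C, A}. dist I Q = r"
      "\<exists>Q\<in>convex hull {A, B}. dist I Q = r"
    using inc by (auto simp: inradius_def)
  then obtain Qa Qb Qc where touch: "Qa \<in> convex hull {B, C}" "dist I Qa = r"
    "Qb \<in> convex hull {C, A}" "dist I Qb = r" "Qc \<in> convex hull {A, B}" "dist I Qc = r" by blast
  \<comment> \<open>The segments from the incentre to the vertices cut the triangle into three triangles of
    height \<open>r\<close>.\<close>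
  have inc2: "4 * r\<^sup>2 * ((a + b + c) / 2)\<^sup>2 = W\<^sup>2"
  proof -
    define \<sigma> where "\<sigma> = sgn W"
    have \<sigma>: "\<sigma>\<^sup>2 = 1" using W0 by (simp add: \<sigma>_def power2_eq_square sgn_if)
    have rot: "{A, B, C} = {B, C, A}" "{A, B, C} = {C, A, B}" by auto
    have rt: "W = signed_area2 B C A" "W = signed_area2 C A B"
      by (simp_all add: W_def signed_area2_def algebra_simps)
    have side: "0 \<le> \<sigma> * signed_area2 Q B C" "0 \<le> \<sigma> * signed_area2 Q C A" "0 \<le> \<sigma> * signed_area2 Q A B"
      if "dist I Q \<le> r" for Q
      using triangle_side[of Q A B C] triangle_side[of Q B C A] triangle_side[of Q C A B] that disc
      unfolding \<sigma>_def rt[symmetric] rot[symmetric] W_def[symmetric] by auto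
    have "\<sigma> * signed_area2 I B C = a * r" "\<sigma> * signed_area2 I C A = b * r" "\<sigma> * signed_area2 I A B = c * r"
      using plane_tangent_height[OF \<sigma> r sides(1) abc(1) side(1) touch(2) triangle_edge[OF touch(1)]]
        plane_tangent_height[OF \<sigma> r sides(2) abc(2) side(2) touch(4) triangle_edge[OF touch(3)]]
        plane_tangent_height[OF \<sigma> r sides(3) abc(3) side(3) touch(6) triangle_edge[OF touch(5)]] by blast+
    moreover have "W = signed_area2 I B C + signed_area2 I C A + signed_area2 I A B"
      by (simp add: W_def signed_area2_def algebra_simps)
    ultimately have "\<sigma> * W = (a + b + c) * r" by (simp add: algebra_simps)
    then have "(\<sigma> * W)\<^sup>2 = ((a + b + c) * r)\<^sup>2" by simp
    then show ?thesis using \<sigma> by (simp add: power_mult_distrib power_divide mult.commute)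
  qed
  have "(a + b + c) * ((b + c - a) * (c + a - b) * (a + b - c)) > 0"
    unfolding heron16[symmetric] using W0 by simp
  then have "(b + c - a) * (c + a - b) * (a + b - c) > 0"
    using abc by (simp add: zero_less_mult_iff)
  then have XYZ: "b + c - a > 0" "c + a - b > 0" "a + b - c > 0"
    by (rule three_positive_factors; use abc in linarith)+
  have prod: "x / 2 * (y / 2) = ((x + y) / 2 / 2)\<^sup>2 - ((x - y) / 2 / 2)\<^sup>2" for x y :: real
    by (simp add: power2_eq_square field_simps)
  have chord: "(a / 2 + b / 2 + c / 2) * ((b / 2 + c / 2 - a / 2) * (c / 2 + a / 2 - b / 2) * (a / 2 + b / 2 - c / 2)) > 0"
    using abc XYZ by (intro mult_pos_pos) auto
  have heron: "W\<^sup>2 = 4 * ((a + b + c) / 2) * ((b + c - a) / 2 * ((c + a - b) / 2) * ((a + b - c) / 2))"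
  proof -
    have *: "4 * (p / 2) * (x / 2 * (y / 2) * (z / 2)) = p * (x * y * z) / 4" for p x y z :: real by simp
    show ?thesis unfolding * heron16[symmetric] by simp
  qed
  have circ3: "R\<^sup>2 * W\<^sup>2 = 16 * (a / 2 * (b / 2) * (c / 2))\<^sup>2"
    using circ2 by (simp add: power_mult_distrib power_divide)
  show ?thesis
  proof (rule mean_ratio_bounds[where s = "\<lambda>x. x / 2" and k = "\<lambda>x. 1" and a = a and b = b and c = c
        and D = "W\<^sup>2" and T = R and t = r])
    show "x / 2 * (y / 2) = ((x + y) / 2 / 2)\<^sup>2 - ((x - y) / 2 / 2)\<^sup>2" for x y :: real
      by (rule prod)
    show "x / 2 + y / 2 = 2 * ((x + y) / 2 / 2) * 1" for x y :: real by simp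
    show "2 * x / 2 = 2 * (x / 2) * 1" for x :: real by simp
    show "((a - b) / 2 / 2 = 0) = (a = b)" "((b - c) / 2 / 2 = 0) = (b = c)" "((c - a) / 2 / 2 = 0) = (c = a)"
      by simp_all
    show "0 < a / 2" "0 < b / 2" "0 < c / 2" "0 < (a + b) / 2 / 2" "0 < (b + c) / 2 / 2" "0 < (a + c) / 2 / 2"
      "0 < (a + b + c) / 2"
      using abc by simp_all
    show "0 < (b + c - a) / 2" "0 < (c + a - b) / 2" "0 < (a + b - c) / 2"
      using XYZ by (simp_all only: half_gt_zero)
  qed (fact chord heron R circ3 r inc2)+
qed

section \<open>The three geometries together\<close>

theorem theorem2p7:
  shows
   "(\<forall>(A::real^2) B C a b c R r.
       \<not> collinear {A, B, C} \<and>
       a = dist B C \<and> b = dist C A \<and> c = dist A B \<and>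
       circumradius UNIV dist A B C R \<and>
       inradius UNIV dist (\<lambda>V. convex hull V) A B C r \<longrightarrow>
       R / r \<ge> mean_ratio (\<lambda>x. x / 2) a b c \<and>
       mean_ratio (\<lambda>x. x / 2) a b c \<ge> 2 \<and>
       (R / r = mean_ratio (\<lambda>x. x / 2) a b c \<longleftrightarrow> a = b \<and> b = c) \<and>
       (mean_ratio (\<lambda>x. x / 2) a b c = 2 \<longleftrightarrow> a = b \<and> b = c)) \<and>
    (\<forall>A B C a b c R r.
       A \<in> H2 \<and> B \<in> H2 \<and> C \<in> H2 \<and> (\<nexists>L. hyperbolic_line L \<and> {A, B, C} \<subseteq> L) \<and>
       a = hdist B C \<and> b = hdist C A \<and> c = hdist A B \<and>
       circumradius H2 hdist A B C R \<and>
       inradius H2 hdist hhull A B C r \<longrightarrow>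
       tanh R / tanh r \<ge> mean_ratio (\<lambda>x. sinh (x / 2)) a b c \<and>
       mean_ratio (\<lambda>x. sinh (x / 2)) a b c \<ge> 2 \<and>
       (tanh R / tanh r = mean_ratio (\<lambda>x. sinh (x / 2)) a b c \<longleftrightarrow> a = b \<and> b = c) \<and>
       (mean_ratio (\<lambda>x. sinh (x / 2)) a b c = 2 \<longleftrightarrow> a = b \<and> b = c)) \<and>
    (\<forall>A B C a b c R r.
       A \<in> S2 \<and> B \<in> S2 \<and> C \<in> S2 \<and> (\<nexists>G. great_circle G \<and> {A, B, C} \<subseteq> G) \<and>
       a = sdist B C \<and> b = sdist C A \<and> c = sdist A B \<and>
       circumradius S2 sdist A B C R \<and> R < pi / 2 \<and>
       inradius S2 sdist shull A B C r \<and> r < pi / 2 \<longrightarrow>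
       tan R / tan r \<ge> mean_ratio (\<lambda>x. sin (x / 2)) a b c \<and>
       mean_ratio (\<lambda>x. sin (x / 2)) a b c \<ge> 2 \<and>
       (tan R / tan r = mean_ratio (\<lambda>x. sin (x / 2)) a b c \<longleftrightarrow> a = b \<and> b = c) \<and>
       (mean_ratio (\<lambda>x. sin (x / 2)) a b c = 2 \<longleftrightarrow> a = b \<and> b = c))"
  apply (rule conjI[OF _ conjI]; (rule allI)+; rule impI; (erule conjE)+)
    apply (rule euclidean_case; assumption)
   apply (rule hyperbolic_case; assumption)
  apply (rule spherical_case; assumption)
  done

end
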